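(* Let $M$ be a real symmetric $d\times d$ matrix, $J$ a constant real skew-symmetric $d\times d$ matrix, $U:\mathbb{R}^d\to\mathbb{R}$ a polynomial, and $p$ a positive integer. Let $\bar U:(\mathbb{R}^d)^p\to\mathbb{R}$ be a quadratic polarization of $U$ in $p$ arguments and let $\overline{\nabla}\bar U$ be a polarized discrete gradient for $\bar U$. Let $h>0$ and let $(y_n)_{n\ge0}$ be a sequence in $\mathbb{R}^d$ satisfying, for all $n\ge0$, the scheme $$y_{n+p}=\exp(phJM)\,y_n+ph\,\phi(phJM)\,J\,\overline{\nabla}\bar U(y_n,y_{n+1},\dots,y_{n+p}).$$ Then the scheme preserves the polarized energy $$\bar H(y_n,\dots,y_{n+p-1})=\frac1{2p}\sum_{i=0}^{p-1}y_{n+i}^TMy_{n+i}+\bar U(y_n,\dots,y_{n+p-1}),$$ that is, $\bar H(y_{n+1},\dots,y_{n+p})=\bar H(y_n,\dots,y_{n+p-1})$ for all $n\ge0$.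
   Context: The scheme is a numerical method with step size $h$ for the system $\dot y=J\nabla H(y)=JMy+J\nabla U(y)$ with $H(y)=\frac12y^TMy+U(y)$. $\phi$ is the entire function $\phi(z)=\frac{e^z-1}{z}$ (with $\phi(0)=1$), and for a square matrix $V$, $\phi(V)=\sum_{k\ge0}\frac{V^k}{(k+1)!}$. A quadratic polarization of $U$ in $p$ arguments is a polynomial function $\bar U(x_1,\dots,x_p)$, of degree at most two in each of the vector arguments $x_i\in\mathbb{R}^d$, that is consistent with $U$, i.e. $\bar U(x,\dots,x)=U(x)$, and invariant under cyclic permutation of its arguments, i.e. $\bar U(x_1,x_2,\dots,x_p)=\bar U(x_2,\dots,x_p,x_1)$. A polarized discrete gradient for $\bar U$ is a map $\overline{\nabla}\bar U:(\mathbb{R}^d)^{p+1}\to\mathbb{R}^d$ such that for all $x_0,\dots,x_p,x\in\mathbb{R}^d$: $$\bar U(x_1,\dots,x_p)-\bar U(x_0,\dots,x_{p-1})=\tfrac1p(x_p-x_0)^T\,\overline{\nabla}\bar U(x_0,\dots,x_p),\qquad \overline{\nabla}\bar U(x,\dots,x)=\nabla U(x).$$ *)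

theory Defs
  imports "HOL-Analysis.Analysis"
begin

text \<open>
  A tuple of \<open>p\<close> vectors in \<open>\<real>\<^sup>d\<close> is a list of length \<open>p\<close> over \<^typ>\<open>real ^ 'd\<close>; the values of
  functions of such tuples on lists of any other length are irrelevant.
\<close>

text \<open>
  On \<^typ>\<open>real ^ 'd ^ 'd\<close> the type-class multiplication and power act componentwise and
  \<^const>\<open>exp\<close> is not available, so powers with respect to \<open>**\<close> and their series are defined here.
\<close>

primrec matrix_power :: "real ^ 'd ^ 'd \<Rightarrow> nat \<Rightarrow> real ^ 'd ^ 'd" where
  "matrix_power V 0 = mat 1"
| "matrix_power V (Suc k) = V ** matrix_power V k"

definition matrix_exp :: "real ^ 'd ^ 'd \<Rightarrow> real ^ 'd ^ 'd" where
  "matrix_exp V = (\<Sum>k. (1 / fact k) *\<^sub>R matrix_power V k)"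

definition matrix_phi :: "real ^ 'd ^ 'd \<Rightarrow> real ^ 'd ^ 'd" where
  "matrix_phi V = (\<Sum>k. (1 / fact (k + 1)) *\<^sub>R matrix_power V k)"

lemma bounded_bilinear_matrix_mult:
  "bounded_bilinear ((**) :: real ^ 'd ^ 'd \<Rightarrow> real ^ 'd ^ 'd \<Rightarrow> real ^ 'd ^ 'd)"
  unfolding bilinear_conv_bounded_bilinear[symmetric] bilinear_def
proof (intro conjI allI linearI)
  fix A B C :: "real ^ 'd ^ 'd" and r :: real
  show "A ** (B + C) = A ** B + A ** C" by (rule matrix_add_ldistrib)
  show "(A + B) ** C = A ** C + B ** C" by (simp add: matrix_matrix_mult_def vec_eq_iff sum.distrib distrib_right)
  show "A ** (r *\<^sub>R B) = r *\<^sub>R (A ** B)"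
    by (simp add: matrix_matrix_mult_def vec_eq_iff sum_distrib_left mult_ac)
  show "(r *\<^sub>R A) ** B = r *\<^sub>R (A ** B)"
    by (simp add: matrix_matrix_mult_def vec_eq_iff sum_distrib_left mult_ac)
qed

lemma matrix_power_norm_bound:
  fixes V :: "real ^ 'd ^ 'd"
  obtains c K where "\<And>k. norm (matrix_power V k) \<le> c * K ^ k"
proof -
  have "\<exists>K>0. \<forall>(A :: real ^ 'd ^ 'd) (B :: real ^ 'd ^ 'd). norm (A ** B) \<le> norm A * norm B * K"
    by (rule bounded_bilinear.pos_bounded[OF bounded_bilinear_matrix_mult])
  then obtain K where "0 < K"
    and K: "\<forall>(A :: real ^ 'd ^ 'd) (B :: real ^ 'd ^ 'd). norm (A ** B) \<le> norm A * norm B * K"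
    by (elim exE conjE) (rule that)
  define L where "L = norm V * K"
  have "0 \<le> L"
    using \<open>0 < K\<close> by (simp add: L_def)
  have step: "norm (V ** A) \<le> L * norm A" for A :: "real ^ 'd ^ 'd"
  proof -
    have "norm (V ** A) \<le> norm V * norm A * K"
      by (rule K[rule_format])
    also have "\<dots> = L * norm A"
      unfolding L_def by (simp only: mult_ac)
    finally show ?thesis .
  qed
  have "norm (matrix_power V k) \<le> norm (mat 1 :: real ^ 'd ^ 'd) * L ^ k" for k
  proof (induction k)
    case 0
    show ?case by (simp only: matrix_power.simps power_0 mult_1_right order_refl)
  next
    case (Suc k)
    have "norm (matrix_power V (Suc k)) \<le> L * norm (matrix_power V k)"
      by (simp only: matrix_power.simps step)
    also have "\<dots> \<le> L * (norm (mat 1 :: real ^ 'd ^ 'd) * L ^ k)"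
      by (rule mult_left_mono[OF Suc \<open>0 \<le> L\<close>])
    finally show ?case by (simp only: power_Suc mult_ac)
  qed
  then show thesis by (rule that)
qed

text \<open>Both series converge absolutely, so \<^const>\<open>suminf\<close> is their sum in the usual sense.\<close>

lemma summable_norm_matrix_exp: "summable (\<lambda>k. norm ((1 / fact k) *\<^sub>R matrix_power V k))"
proof -
  obtain c K where cK: "\<And>k. norm (matrix_power V k) \<le> c * K ^ k" using matrix_power_norm_bound[of V] by metis
  have "summable (\<lambda>k. c * (inverse (fact k) * K ^ k))"
    by (rule summable_mult[OF summable_exp])
  then show ?thesis
  proof (rule summable_comparison_test'[where N = 0])
    show "norm (norm ((1 / fact k) *\<^sub>R matrix_power V k)) \<le> c * (inverse (fact k) * K ^ k)" for k
      using mult_left_mono[OF cK[of k], of "inverse (fact k)"] by (simp add: divide_inverse ac_simps)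
  qed
qed

lemma summable_norm_matrix_phi: "summable (\<lambda>k. norm ((1 / fact (k + 1)) *\<^sub>R matrix_power V k))"
proof (rule summable_comparison_test'[where N = 0, OF summable_norm_matrix_exp])
  show "norm (norm ((1 / fact (k + 1)) *\<^sub>R matrix_power V k))
      \<le> norm ((1 / fact k) *\<^sub>R matrix_power V k)" for k
  proof -
    have "(fact k :: real) \<le> fact (k + 1)"
      by (rule fact_mono) simp
    then have "1 / fact (k + 1) \<le> (1 / fact k :: real)"
      by (rule divide_left_mono) (simp_all del: fact_Suc)
    then have "1 / fact (k + 1) * norm (matrix_power V k) \<le> 1 / fact k * norm (matrix_power V k)"
      by (rule mult_right_mono) simp
    then show ?thesis
      by (simp del: fact_Suc add_Suc_right)
  qed
qed

text \<open>
  Polynomial functions of \<open>p\<close> vector arguments with degree at most two in each of them: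
  \<open>\<alpha> i j\<close> is the exponent of the \<open>j\<close>-th coordinate of the \<open>i\<close>-th argument, so that
  \<open>\<Sum>j\<in>UNIV. \<alpha> i j\<close> is the degree of the monomial in the \<open>i\<close>-th argument.
\<close>

definition quadratic_in_each :: "nat \<Rightarrow> ((real ^ 'd) list \<Rightarrow> real) \<Rightarrow> bool" where
  "quadratic_in_each p F \<longleftrightarrow>
     (\<exists>(A :: (nat \<Rightarrow> 'd \<Rightarrow> nat) set) c. finite A \<and>
        (\<forall>\<alpha>\<in>A. \<forall>i<p. (\<Sum>j\<in>UNIV. \<alpha> i j) \<le> 2) \<and>
        (\<forall>xs. length xs = p \<longrightarrow>
           F xs = (\<Sum>\<alpha>\<in>A. c \<alpha> * (\<Prod>i<p. \<Prod>j\<in>UNIV. (xs ! i $ j) ^ \<alpha> i j))))"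

definition quadratic_polarization ::
    "nat \<Rightarrow> (real ^ 'd \<Rightarrow> real) \<Rightarrow> ((real ^ 'd) list \<Rightarrow> real) \<Rightarrow> bool" where
  "quadratic_polarization p U Ubar \<longleftrightarrow>
     quadratic_in_each p Ubar \<and>
     (\<forall>x. Ubar (replicate p x) = U x) \<and>
     (\<forall>xs. length xs = p \<longrightarrow> Ubar xs = Ubar (rotate1 xs))"

text \<open>The list \<open>xs\<close> below is \<open>[x\<^sub>0, \<dots>, x\<^sub>p]\<close>.\<close>

definition polarized_discrete_gradient ::
    "nat \<Rightarrow> (real ^ 'd \<Rightarrow> real) \<Rightarrow> ((real ^ 'd) list \<Rightarrow> real) \<Rightarrow>
       ((real ^ 'd) list \<Rightarrow> real ^ 'd) \<Rightarrow> bool" where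
  "polarized_discrete_gradient p U Ubar D \<longleftrightarrow>
     (\<forall>xs. length xs = p + 1 \<longrightarrow>
        Ubar (tl xs) - Ubar (butlast xs) = (1 / real p) * ((xs ! p - xs ! 0) \<bullet> D xs)) \<and>
     (\<forall>x. GDERIV U x :> D (replicate (p + 1) x))"

definition polarized_energy ::
    "nat \<Rightarrow> real ^ 'd ^ 'd \<Rightarrow> ((real ^ 'd) list \<Rightarrow> real) \<Rightarrow> (real ^ 'd) list \<Rightarrow> real" where
  "polarized_energy p M Ubar xs =
     (1 / (2 * real p)) * (\<Sum>i<p. (xs ! i) \<bullet> (M *v (xs ! i))) + Ubar xs"

end

theory Submission
  imports Defs
begin

text \<open>
  With \<open>t = ph\<close> and \<open>g\<close> the value of the discrete gradient, one step of the scheme maps \<open>y\<^sub>n\<close> to the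
  value at time \<open>t\<close> of the solution of the affine equation \<open>z' = JMz + Jg\<close>, \<open>z(0) = y\<^sub>n\<close>. As \<open>J\<close> is
  skew and the right-hand side is \<open>J(Mz + g)\<close>, this flow preserves \<open>z\<^sup>TMz/2 + g\<^sup>Tz\<close>. The change of the
  quadratic part of the polarized energy is therefore minus the change of \<open>g\<^sup>Tz/p\<close>, which the
  discrete gradient identity identifies with the change of the polarized potential.
\<close>

text \<open>Pairing with a vector \<open>b\<close> turns both series into real power series, for
  which termwise differentiation is known; \<open>sm\<close> and \<open>sm'\<close> let the inner
  product pass through the sums. Differentiability of all components then gives the vector
  statement.\<close>

lemma has_vector_derivative_powser:
  fixes c :: "nat \<Rightarrow> 'a::euclidean_space"
  assumes sm: "\<And>s::real. summable (\<lambda>k. s ^ k *\<^sub>R c k)"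
    and sm': "\<And>s::real. summable (\<lambda>k. s ^ k *\<^sub>R (real (Suc k) *\<^sub>R c (Suc k)))"
  shows "((\<lambda>s. \<Sum>k. s ^ k *\<^sub>R c k) has_vector_derivative
           (\<Sum>k. s ^ k *\<^sub>R (real (Suc k) *\<^sub>R c (Suc k)))) (at s)"
proof -
  have "((\<lambda>s. (\<Sum>k. s ^ k *\<^sub>R c k) \<bullet> b) has_real_derivative
           (\<Sum>k. s ^ k *\<^sub>R (real (Suc k) *\<^sub>R c (Suc k))) \<bullet> b) (at s)" for b
  proof -
    have inner_summable: "summable (\<lambda>k. (c k \<bullet> b) * s ^ k)" for s :: real
      using bounded_linear.summable[OF bounded_linear_inner_left[of b] sm[of s]]
      by (simp add: mult.commute)
    have "(\<Sum>k. s ^ k *\<^sub>R c k) \<bullet> b = (\<Sum>k. (c k \<bullet> b) * s ^ k)" for s :: real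
      using bounded_linear.suminf[OF bounded_linear_inner_left[of b] sm[of s]]
      by (simp add: mult.commute)
    moreover have "(\<Sum>k. s ^ k *\<^sub>R (real (Suc k) *\<^sub>R c (Suc k))) \<bullet> b
        = (\<Sum>k. diffs (\<lambda>k. c k \<bullet> b) k * s ^ k)"
      using bounded_linear.suminf[OF bounded_linear_inner_left[of b] sm'[of s]]
      by (simp add: diffs_def mult_ac del: of_nat_Suc)
    ultimately show ?thesis
      using termdiffs_strong_converges_everywhere[OF inner_summable, of s] by simp
  qed
  then have "((\<lambda>s. (\<Sum>k. s ^ k *\<^sub>R c k) \<bullet> b) has_derivative
      (\<lambda>x. (x *\<^sub>R (\<Sum>k. s ^ k *\<^sub>R (real (Suc k) *\<^sub>R c (Suc k)))) \<bullet> b)) (at s)" for b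
    by (simp add: has_field_derivative_def mult_commute_abs)
  then show ?thesis
    unfolding has_vector_derivative_def by (subst has_derivative_componentwise_within) blast
qed

lemma matrix_power_scaleR: "matrix_power (s *\<^sub>R A) k = s ^ k *\<^sub>R matrix_power A k"
  by (induction k)
    (simp_all add: bounded_bilinear.scaleR_left[OF bounded_bilinear_matrix_mult]
      bounded_bilinear.scaleR_right[OF bounded_bilinear_matrix_mult] mult.commute)

lemma summable_matrix_exp: "summable (\<lambda>k. (1 / fact k) *\<^sub>R matrix_power V k)"
  by (rule summable_norm_cancel[OF summable_norm_matrix_exp])

lemma summable_matrix_phi: "summable (\<lambda>k. (1 / fact (k + 1)) *\<^sub>R matrix_power V k)"
  by (rule summable_norm_cancel[OF summable_norm_matrix_phi])

text \<open>Multiplying the \<open>matrix_phi\<close> series by \<open>V\<close> shifts the index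
  and yields the exponential series without its constant term. This form of the definition of phi
  requires no inverse of \<open>V\<close>.\<close>

lemma matrix_exp_eq_phi: "matrix_exp V = mat 1 + V ** matrix_phi V"
proof -
  have "V ** matrix_phi V = (\<Sum>k. (1 / fact (k + 1)) *\<^sub>R matrix_power V (Suc k))"
    unfolding matrix_phi_def
    by (subst bounded_linear.suminf[OF bounded_bilinear.bounded_linear_right
          [OF bounded_bilinear_matrix_mult] summable_matrix_phi])
      (simp add: bounded_bilinear.scaleR_right[OF bounded_bilinear_matrix_mult] del: fact_Suc)
  also have "\<dots> = matrix_exp V - mat 1"
    unfolding matrix_exp_def using suminf_split_head[OF summable_matrix_exp, of V]
    by (simp del: fact_Suc)
  finally show ?thesis by simp
qed

lemma matrix_exp_has_vector_derivative:
  "((\<lambda>s. matrix_exp (s *\<^sub>R A)) has_vector_derivative A ** matrix_exp (s *\<^sub>R A)) (at s)"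
proof -
  define c where "c k = (1 / fact k) *\<^sub>R matrix_power A k" for k
  \<comment> \<open>The factor \<open>Suc k\<close> cancels against the factorial, so termwise
    differentiation acts on the coefficients as left multiplication by \<open>A\<close>.\<close>
  have diff_c: "real (Suc k) *\<^sub>R c (Suc k) = A ** c k" for k
    by (simp add: c_def bounded_bilinear.scaleR_right[OF bounded_bilinear_matrix_mult]
        del: of_nat_Suc)
  have exp_term: "s ^ k *\<^sub>R c k = (1 / fact k) *\<^sub>R matrix_power (s *\<^sub>R A) k" for k s
    by (simp add: c_def matrix_power_scaleR)
  have sm: "summable (\<lambda>k. s ^ k *\<^sub>R c k)" for s
    unfolding exp_term by (rule summable_matrix_exp)
  have diff_term: "s ^ k *\<^sub>R (A ** c k) = A ** (s ^ k *\<^sub>R c k)" for k s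
    by (simp add: bounded_bilinear.scaleR_right[OF bounded_bilinear_matrix_mult])
  note bl = bounded_bilinear.bounded_linear_right[OF bounded_bilinear_matrix_mult, of A]
  have "((\<lambda>s. \<Sum>k. s ^ k *\<^sub>R c k) has_vector_derivative
      (\<Sum>k. s ^ k *\<^sub>R (real (Suc k) *\<^sub>R c (Suc k)))) (at s)"
    by (rule has_vector_derivative_powser)
      (simp_all only: sm diff_c diff_term bounded_linear.summable[OF bl sm])
  then show ?thesis
    unfolding diff_c diff_term bounded_linear.suminf[OF bl sm, symmetric]
    unfolding exp_term matrix_exp_def .
qed

text \<open>The function is the antiderivative of \<open>matrix_exp (s *\<^sub>R A)\<close>
  vanishing at 0; it carries the constant inhomogeneity in \<open>affine_flow\<close>.\<close>

lemma matrix_phi_has_vector_derivative: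
  "((\<lambda>s. s *\<^sub>R matrix_phi (s *\<^sub>R A)) has_vector_derivative matrix_exp (s *\<^sub>R A)) (at s)"
proof -
  \<comment> \<open>The extra factor \<open>s\<close> raises each exponent by one, so the
    coefficients are shifted and the constant term is 0.\<close>
  define c where "c k = (case k of 0 \<Rightarrow> 0 | Suc j \<Rightarrow> (1 / fact k) *\<^sub>R matrix_power A j)" for k
  have phi_term: "s ^ Suc k *\<^sub>R c (Suc k)
      = s *\<^sub>R ((1 / fact (k + 1)) *\<^sub>R matrix_power (s *\<^sub>R A) k)" for k s
    by (simp add: c_def matrix_power_scaleR mult_ac del: fact_Suc)
  have exp_term: "s ^ k *\<^sub>R (real (Suc k) *\<^sub>R c (Suc k))
      = (1 / fact k) *\<^sub>R matrix_power (s *\<^sub>R A) k" for k s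
    by (simp add: c_def matrix_power_scaleR del: of_nat_Suc)
  have sm: "summable (\<lambda>k. s ^ k *\<^sub>R c k)" for s
    by (subst summable_Suc_iff[symmetric], unfold phi_term)
      (rule summable_scaleR_right[OF summable_matrix_phi])
  have sum_eq: "(\<Sum>k. s ^ k *\<^sub>R c k) = s *\<^sub>R matrix_phi (s *\<^sub>R A)" for s
  proof -
    have "(\<Sum>k. s ^ k *\<^sub>R c k) = (\<Sum>k. s ^ Suc k *\<^sub>R c (Suc k))"
      using suminf_split_head[OF sm, of s] by (simp add: c_def)
    also have "\<dots> = s *\<^sub>R matrix_phi (s *\<^sub>R A)"
      unfolding phi_term matrix_phi_def by (rule suminf_scaleR_right[symmetric, OF summable_matrix_phi])
    finally show ?thesis .
  qed
  have "((\<lambda>s. \<Sum>k. s ^ k *\<^sub>R c k) has_vector_derivative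
      (\<Sum>k. s ^ k *\<^sub>R (real (Suc k) *\<^sub>R c (Suc k)))) (at s)"
    by (rule has_vector_derivative_powser) (simp_all only: sm exp_term summable_matrix_exp)
  then show ?thesis
    unfolding sum_eq exp_term matrix_exp_def .
qed

text \<open>Variation of constants: the solution at time \<open>s\<close> of z' = Az + b with z(0) =
  a.\<close>

definition affine_flow :: "real ^ 'd ^ 'd \<Rightarrow> real ^ 'd \<Rightarrow> real ^ 'd \<Rightarrow> real \<Rightarrow> real ^ 'd" where
  "affine_flow A b a s = matrix_exp (s *\<^sub>R A) *v a + (s *\<^sub>R matrix_phi (s *\<^sub>R A)) *v b"

lemma affine_flow_0: "affine_flow A b a 0 = a"
  by (simp add: affine_flow_def matrix_exp_eq_phi)

lemma affine_flow_has_vector_derivative: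
  "(affine_flow A b a has_vector_derivative A *v affine_flow A b a s + b) (at s)"
proof -
  have bl: "bounded_linear (\<lambda>X :: real ^ 'd ^ 'd. X *v x)" for x :: "real ^ 'd"
    unfolding linear_conv_bounded_linear[symmetric]
    by (rule linearI) (simp_all add: matrix_vector_mult_add_rdistrib scaleR_matrix_vector_assoc)
  have "(affine_flow A b a has_vector_derivative
      (A ** matrix_exp (s *\<^sub>R A)) *v a + matrix_exp (s *\<^sub>R A) *v b) (at s)"
    unfolding affine_flow_def [abs_def]
    by (intro has_vector_derivative_add bounded_linear.has_vector_derivative[OF bl]
        matrix_exp_has_vector_derivative matrix_phi_has_vector_derivative)
  \<comment> \<open>\<open>matrix_exp_eq_phi\<close> splits the derivative of the forcing term into
    \<open>A\<close> applied to that term, plus \<open>b\<close>.\<close>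
  moreover have "matrix_exp (s *\<^sub>R A) *v b = A *v ((s *\<^sub>R matrix_phi (s *\<^sub>R A)) *v b) + b"
    by (simp add: matrix_exp_eq_phi matrix_vector_mult_add_rdistrib matrix_vector_mul_assoc
        bounded_bilinear.scaleR_left[OF bounded_bilinear_matrix_mult]
        bounded_bilinear.scaleR_right[OF bounded_bilinear_matrix_mult])
  ultimately show ?thesis
    by (simp add: affine_flow_def matrix_vector_right_distrib matrix_vector_mul_assoc add.assoc)
qed

lemma skew_matrix_quadratic_form:
  fixes J :: "real ^ 'd ^ 'd"
  assumes "transpose J = - J"
  shows "w \<bullet> (J *v w) = 0"
proof -
  have "w \<bullet> (J *v w) = (transpose J *v w) \<bullet> w"
    by (simp add: dot_lmul_matrix)
  also have "\<dots> = - (w \<bullet> (J *v w))"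
    by (simp add: assms inner_commute matrix_vector_mult_def sum_negf inner_vec_def)
  finally show ?thesis by simp
qed

lemma symmetric_matrix_inner_commute:
  fixes M :: "real ^ 'd ^ 'd"
  assumes "transpose M = M"
  shows "x \<bullet> (M *v y) = y \<bullet> (M *v x)"
  by (metis assms dot_lmul_matrix inner_commute transpose_matrix_vector)

lemma affine_flow_energy:
  fixes M J :: "real ^ 'd ^ 'd" and a g :: "real ^ 'd"
  assumes "transpose M = M" and "transpose J = - J"
  defines "z \<equiv> affine_flow (J ** M) (J *v g) a"
  shows "z t \<bullet> (M *v z t) / 2 + g \<bullet> z t = a \<bullet> (M *v a) / 2 + g \<bullet> a"
proof -
  define H where "H x = x \<bullet> (M *v x) / 2 + g \<bullet> x" for x
  have "((\<lambda>s. H (z s)) has_real_derivative 0) (at s)" for s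
  proof -
    \<comment> \<open>Since \<open>M\<close> is symmetric, \<open>w\<close> is the gradient of
      \<open>H\<close> at \<open>z s\<close>. The flow reads z' = Jw, so \<open>H\<close> changes at
      the rate \<open>w \<bullet> (J *v w)\<close>, which is zero by skewness.\<close>
    define w where "w = M *v z s + g"
    have z': "(z has_vector_derivative J *v w) (at s)"
      using affine_flow_has_vector_derivative[of "J ** M" "J *v g" a s]
      by (simp add: z_def w_def matrix_vector_right_distrib matrix_vector_mul_assoc)
    have Mz': "((\<lambda>s. M *v z s) has_vector_derivative M *v (J *v w)) (at s)"
      by (rule bounded_linear.has_vector_derivative[OF matrix_vector_mul_bounded_linear z'])
    have "((\<lambda>s. z s \<bullet> (M *v z s)) has_vector_derivative
        z s \<bullet> (M *v (J *v w)) + (J *v w) \<bullet> (M *v z s)) (at s)"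
      by (rule bounded_bilinear.has_vector_derivative[OF bounded_bilinear_inner z' Mz'])
    moreover have "((\<lambda>s. g \<bullet> z s) has_vector_derivative g \<bullet> (J *v w)) (at s)"
      by (rule bounded_linear.has_vector_derivative[OF bounded_linear_inner_right z'])
    ultimately have "((\<lambda>s. H (z s)) has_real_derivative
        (z s \<bullet> (M *v (J *v w)) + (J *v w) \<bullet> (M *v z s)) / 2 + g \<bullet> (J *v w)) (at s)"
      unfolding H_def has_real_derivative_iff_has_vector_derivative[symmetric]
      by (intro DERIV_add DERIV_cdivide)
    moreover have "(z s \<bullet> (M *v (J *v w)) + (J *v w) \<bullet> (M *v z s)) / 2 + g \<bullet> (J *v w)
        = w \<bullet> (J *v w)"
      using symmetric_matrix_inner_commute[OF assms(1), of "z s" "J *v w"]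
      by (simp add: w_def inner_add_left inner_commute)
    ultimately show ?thesis
      by (simp only: skew_matrix_quadratic_form[OF assms(2)])
  qed
  then have "H (z t) = H (z 0)"
    by (intro DERIV_isconst_all) blast
  then show ?thesis
    by (simp add: H_def z_def affine_flow_0)
qed

theorem corollary1:
  fixes M J :: "real ^ 'd ^ 'd"
    and U :: "real ^ 'd \<Rightarrow> real"
    and p :: nat
    and Ubar :: "(real ^ 'd) list \<Rightarrow> real"
    and D :: "(real ^ 'd) list \<Rightarrow> real ^ 'd"
    and h :: real
    and y :: "nat \<Rightarrow> real ^ 'd"
  assumes "transpose M = M"
    and "transpose J = - J"
    and "real_polynomial_function U"
    and "p > 0"
    and "quadratic_polarization p U Ubar"
    and "polarized_discrete_gradient p U Ubar D"
    and "h > 0"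
    and "\<And>n. y (n + p) =
           matrix_exp ((real p * h) *\<^sub>R (J ** M)) *v y n
           + (real p * h) *\<^sub>R
               (matrix_phi ((real p * h) *\<^sub>R (J ** M)) *v (J *v D (map y [n..<n + p + 1])))"
  shows "\<forall>n. polarized_energy p M Ubar (map y [n + 1..<n + 1 + p])
           = polarized_energy p M Ubar (map y [n..<n + p])"
proof
  fix n
  define g where "g = D (map y [n..<n + p + 1])"
  define t where "t = real p * h"
  define Q where "Q x = x \<bullet> (M *v x)" for x
  \<comment> \<open>Although \<open>g\<close> depends on \<open>y (n + p)\<close> itself, it is a
    fixed vector once the sequence is given, so the implicit scheme is an exact affine flow over
    time \<open>t\<close>.\<close>
  have "y (n + p) = affine_flow (J ** M) (J *v g) (y n) t"
    using assms(8)[of n]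
    by (simp add: affine_flow_def g_def t_def scaleR_matrix_vector_assoc)
  then have flow: "Q (y (n + p)) - Q (y n) = - 2 * ((y (n + p) - y n) \<bullet> g)"
    using affine_flow_energy[OF assms(1,2), of g "y n" t]
    by (simp add: Q_def algebra_simps inner_commute[of g])
  \<comment> \<open>Dropping the first or the last of the \<open>p + 1\<close> values gives the two
    windows compared by the discrete gradient identity.\<close>
  have "tl (map y [n..<n + p + 1]) = map y [n + 1..<n + 1 + p]"
    by (simp add: map_tl[symmetric] del: upt_Suc)
  moreover have "butlast (map y [n..<n + p + 1]) = map y [n..<n + p]"
    by (simp add: butlast_append)
  moreover have "map y [n..<n + p + 1] ! p = y (n + p)" "map y [n..<n + p + 1] ! 0 = y n"
    by (simp_all del: upt_Suc)
  moreover have "length (map y [n..<n + p + 1]) = p + 1"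
    by simp
  ultimately have potential: "Ubar (map y [n + 1..<n + 1 + p]) - Ubar (map y [n..<n + p])
      = (1 / real p) * ((y (n + p) - y n) \<bullet> g)"
    using assms(6) unfolding polarized_discrete_gradient_def g_def by metis
  \<comment> \<open>Consecutive windows share all but their outer entries, so the difference
    telescopes to the endpoints, exactly the quantity in \<open>flow\<close>.\<close>
  have "(\<Sum>i<p. Q (map y [n + 1..<n + 1 + p] ! i)) - (\<Sum>i<p. Q (map y [n..<n + p] ! i))
      = (\<Sum>i<p. Q (y (n + Suc i)) - Q (y (n + i)))"
    by (simp add: sum_subtractf del: upt_Suc)
  also have "\<dots> = Q (y (n + p)) - Q (y n)"
    using sum_lessThan_telescope[of "\<lambda>i. Q (y (n + i))" p] by simp
  finally have "(\<Sum>i<p. Q (map y [n + 1..<n + 1 + p] ! i))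
      = (\<Sum>i<p. Q (map y [n..<n + p] ! i)) - 2 * ((y (n + p) - y n) \<bullet> g)"
    using flow by linarith
  \<comment> \<open>The weight 1/(2p) turns the quadratic change into -1/p times the inner product,
    cancelling \<open>potential\<close>.\<close>
  then show "polarized_energy p M Ubar (map y [n + 1..<n + 1 + p])
      = polarized_energy p M Ubar (map y [n..<n + p])"
    using potential \<open>p > 0\<close>
    unfolding polarized_energy_def Q_def[symmetric] by (simp add: field_simps del: upt_Suc)
qed

end
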